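(* For every integer $d\geq 3$, there exists a $2$-connected graph $G_d$ with girth at least $d$ such that $\mathrm{spc}(G_d) \geq 4$.
   Context: Graphs are finite, simple and connected. A graph is $k$-connected if it cannot be disconnected by deleting $k-1$ vertices. In a graph with colored edges (the coloring is arbitrary; adjacent edges may share a color), a path is strongly proper if its sequence of edge colors does not contain identical terms within a distance of at most two, i.e. any two distinct edges of the path that are consecutive on the path, or separated by exactly one edge on the path, have different colors. An edge-colored graph is strongly proper connected if every two distinct vertices are joined by at least one strongly proper path. $\mathrm{spc}(G)$ denotes the least number of colors in an edge coloring of $G$ that makes $G$ strongly proper connected. *)

theory Defs
  imports "Graph_Theory.Graph_Theory" "HOL-Library.Extended_Nat"
begin

text \<open>
  An undirected edge joining \<open>u\<close> and \<open>v\<close> is represented by the two opposite arcs of a symmetric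
  digraph, so finite simple graphs are the instances of the locale \<^locale>\<open>graph\<close>.
\<close>

text \<open>
  For \<open>k > 0\<close> the case \<open>S = {}\<close> makes the graph itself connected. The bound on the number of
  vertices is the usual convention that excludes small complete graphs.
\<close>

definition k_connected :: "nat \<Rightarrow> ('a, 'b) pre_digraph \<Rightarrow> bool" where
  "k_connected k G \<longleftrightarrow>
     k < card (verts G) \<and>
     (\<forall>S. S \<subseteq> verts G \<and> card S < k \<longrightarrow> connected (G \<restriction> (verts G - S)))"

text \<open>
  The cycles of the underlying undirected graph are the directed cycles of length at least 3: the
  library also counts walking along an edge and back as a cycle, of length 2. The girth of an acyclic
  graph is \<open>\<infinity>\<close>.
\<close>

definition girth :: "('a, 'b) pre_digraph \<Rightarrow> enat" where
  "girth G = (INF p \<in> {p. pre_digraph.cycle G p \<and> 3 \<le> length p}. enat (length p))"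

text \<open>
  A colouring takes the unordered pair \<open>{u, v}\<close> as its argument, so the two arcs that represent an
  edge get the same colour. Its values outside the edges of the graph are irrelevant.
\<close>

definition colour_seq :: "('a set \<Rightarrow> nat) \<Rightarrow> 'a vwalk \<Rightarrow> nat list" where
  "colour_seq c p = map (\<lambda>(u, v). c {u, v}) (vwalk_arcs p)"

definition strongly_proper_path ::
    "('a, 'b) pre_digraph \<Rightarrow> ('a set \<Rightarrow> nat) \<Rightarrow> 'a vwalk \<Rightarrow> bool" where
  "strongly_proper_path G c p \<longleftrightarrow>
     vpath p G \<and>
     (\<forall>i j. i < j \<and> j \<le> i + 2 \<and> j < length (colour_seq c p) \<longrightarrow>
        colour_seq c p ! i \<noteq> colour_seq c p ! j)"

definition strongly_proper_connected ::
    "('a, 'b) pre_digraph \<Rightarrow> ('a set \<Rightarrow> nat) \<Rightarrow> bool" where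
  "strongly_proper_connected G c \<longleftrightarrow>
     (\<forall>u\<in>verts G. \<forall>v\<in>verts G. u \<noteq> v \<longrightarrow>
        (\<exists>p. strongly_proper_path G c p \<and> hd p = u \<and> last p = v))"

text \<open>
  Meaningful for finite connected graphs, where giving all edges distinct colours shows that some
  number of colours suffices.
\<close>

definition spc :: "('a, 'b) pre_digraph \<Rightarrow> nat" where
  "spc G = (LEAST k. \<exists>c. (\<forall>(u, v)\<in>arcs_ends G. c {u, v} < k) \<and> strongly_proper_connected G c)"

end

theory Submission
  imports Defs
begin

text \<open>
  The graph is a generalised theta graph: 28 strands of length \<open>L = 3 * d + 1\<close> that join two
  hubs and share nothing else. Deleting a vertex leaves a connected graph, and a cycle cannot turn
  back inside a strand, so it contains a whole strand and is longer than \<open>d\<close>.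

  Suppose that three colours suffice. Along a strongly proper path any three consecutive edges have
  three different colours, so the colour sequence has period exactly 3
  (\<open>three_colours_periodic\<close>). Number the edges of each strand from 0 to \<open>L - 1\<close>,
  starting at the same hub. There are 27 possible colour triples for the edges 0, 3 and
  \<open>L - 1\<close>, so two strands \<open>i\<close> and \<open>j\<close> have the same triple. Consider a strongly proper path from
  the vertex in position \<open>s\<close> on strand \<open>i\<close> to the vertex in position \<open>s\<close> on strand \<open>j\<close>. It
  cannot pass directly from \<open>i\<close> to \<open>j\<close> at a hub, for the two edges used there have the same colour.
  So it leaves strand \<open>i\<close> through one hub, runs along a third strand, and enters \<open>j\<close> through the
  other hub (\<open>strongly_proper_detour\<close>); it has \<open>2 * L\<close> edges, and the places
  of its edges on \<open>i\<close> and \<open>j\<close> are known.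

  For \<open>s = 4\<close> the edges 0 and 3 of one of the two strands lie on the path at distance 3, and so
  they have the same colour. For \<open>s = 1\<close> edge 0 of one strand and edge 3 of the other lie on the
  path at distance \<open>2 * L - 3\<close>, which is not a multiple of 3 because \<open>L\<close> is not one, and
  so they have different colours. As the two strands agree on the edges 0 and 3, this is a contradiction.
\<close>

section \<open>Colour sequences\<close>

lemma length_vwalk_arcs: "length (vwalk_arcs p) = length p - 1"
  using vwalk_length_simp[of p] unfolding vwalk_length_def .

lemma nth_vwalk_arcs: "Suc e < length p \<Longrightarrow> vwalk_arcs p ! e = (p ! e, p ! Suc e)"
proof (induction p arbitrary: e rule: vwalk_arcs.induct)
  case (3 x y xs)
  then show ?case by (cases e) auto
qed auto

lemma length_colour_seq: "length (colour_seq c p) = length p - 1"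
  by (simp add: colour_seq_def length_vwalk_arcs)

lemma nth_colour_seq: "Suc e < length p \<Longrightarrow> colour_seq c p ! e = c {p ! e, p ! Suc e}"
  by (simp add: colour_seq_def length_vwalk_arcs nth_vwalk_arcs)

lemma vpath_nth_dominates:
  assumes "vpath p G" "Suc e < length p"
  shows "p ! e \<rightarrow>\<^bsub>G\<^esub> p ! Suc e"
proof -
  have "vwalk_arcs p ! e \<in> set (vwalk_arcs p)"
    using assms(2) by (intro nth_mem) (simp add: length_vwalk_arcs)
  then show ?thesis
    using assms by (auto simp: vpath_def vwalk_def nth_vwalk_arcs)
qed

text \<open>
  Three consecutive terms use up all three colours, so the next term repeats the first of them.
\<close>

lemma three_colours_periodic:
  fixes w :: "nat list"
  assumes three: "\<And>e. e < length w \<Longrightarrow> w ! e < 3"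
    and proper: "\<And>e f. e < f \<Longrightarrow> f \<le> e + 2 \<Longrightarrow> f < length w \<Longrightarrow> w ! e \<noteq> w ! f"
    and "e \<le> f" "f < length w"
  shows "w ! e = w ! f \<longleftrightarrow> 3 dvd f - e"
proof -
  have step: "w ! (e + 3) = w ! e" if "e + 3 < length w" for e
  proof -
    have "w ! e < 3" "w ! (e+1) < 3" "w ! (e+2) < 3" "w ! (e+3) < 3"
      using that by (auto intro: three)
    moreover have "w ! e \<noteq> w ! (e+1)" "w ! e \<noteq> w ! (e+2)" "w ! (e+1) \<noteq> w ! (e+2)"
      "w ! (e+1) \<noteq> w ! (e+3)" "w ! (e+2) \<noteq> w ! (e+3)"
      using that by (simp_all add: proper)
    ultimately show ?thesis by linarith
  qed
  have steps: "w ! (e + 3 * k) = w ! e" if "e + 3 * k < length w" for e k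
    using that
  proof (induction k)
    case (Suc k)
    then show ?case using step[of "e + 3 * k"] by (simp add: algebra_simps)
  qed simp
  define k r where "k = (f - e) div 3" and "r = (f - e) mod 3"
  have f: "f = e + r + 3 * k" and "r < 3"
    using \<open>e \<le> f\<close> by (auto simp: k_def r_def)
  have "w ! f = w ! (e + r)"
    using steps[of "e + r" k] f \<open>f < length w\<close> by simp
  moreover have "w ! e \<noteq> w ! (e + r)" if "r \<noteq> 0"
    using that \<open>r < 3\<close> f \<open>f < length w\<close> by (intro proper) auto
  ultimately show ?thesis
    by (cases "r = 0") (auto simp: r_def mod_eq_0_iff_dvd)
qed

text \<open>
  \<^const>\<open>spc\<close> is a least number, about which nothing could be said if no colouring worked. Here
  distinct colours on all edges work, because the edges of a path are distinct.
\<close>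

lemma (in graph) ex_strongly_proper_colouring:
  assumes "connected G"
  shows "\<exists>k c. (\<forall>(u, v)\<in>arcs_ends G. c {u, v} < k) \<and> strongly_proper_connected G c"
proof -
  define E where "E = (\<lambda>(u, v). {u, v}) ` arcs_ends G"
  have "finite E" by (simp add: E_def arcs_ends_def)
  then obtain c :: "'a set \<Rightarrow> nat" and k where c: "c ` E = {i. i < k}" "inj_on c E"
    by (metis finite_imp_inj_to_nat_seg)
  have "c {u, v} < k" if "u \<rightarrow> v" for u v
  proof -
    have "{u, v} \<in> E" using that by (force simp: E_def)
    then show ?thesis using c(1) by blast
  qed
  moreover have "strongly_proper_connected G c"
    unfolding strongly_proper_connected_def
  proof (intro ballI impI)
    fix u v assume "u \<in> verts G" "v \<in> verts G" "u \<noteq> v"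
    then have "u \<rightarrow>\<^sup>* v"
      using symmetric_connected_imp_strongly_connected[OF sym_arcs assms]
      by (auto simp: strongly_connected_def)
    then obtain p where p: "vpath p G" "hd p = u" "last p = v"
      by (auto simp: reachable_vpath_conv)
    have "colour_seq c p ! e \<noteq> colour_seq c p ! f" if "e < f" "f < length (colour_seq c p)" for e f
    proof
      assume eq: "colour_seq c p ! e = colour_seq c p ! f"
      have len: "Suc e < length p" "Suc f < length p"
        using that by (auto simp: length_colour_seq)
      have "{p ! e, p ! Suc e} \<in> E" "{p ! f, p ! Suc f} \<in> E"
        using vpath_nth_dominates[OF p(1)] len by (force simp: E_def)+
      then have "{p ! e, p ! Suc e} = {p ! f, p ! Suc f}"
        using eq len c(2) by (auto simp: nth_colour_seq inj_on_def)
      moreover have "p ! e \<notin> {p ! f, p ! Suc f}"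
        using p(1) \<open>e < f\<close> len by (auto simp: vpath_def nth_eq_iff_index_eq)
      ultimately show False by blast
    qed
    then have "strongly_proper_path G c p"
      using p(1) by (auto simp: strongly_proper_path_def)
    then show "\<exists>p. strongly_proper_path G c p \<and> hd p = u \<and> last p = v"
      using p by blast
  qed
  ultimately show ?thesis by blast
qed

section \<open>Generalised theta graphs\<close>

text \<open>
  \<open>Q i s\<close> is the vertex in position \<open>s\<close> on strand \<open>i\<close>; the positions \<open>0\<close> and \<open>L\<close> are the hubs.
  The axioms describe the graph instead of constructing it, so that reading all strands
  backwards gives an instance for the same graph.
\<close>

locale theta_graph = graph G for G :: "('a, 'b) pre_digraph" (structure) +
  fixes Q :: "nat \<Rightarrow> nat \<Rightarrow> 'a" and m L :: nat
  assumes two_strands: "2 \<le> m"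
    and length_strand: "2 \<le> L"
    and first_hub: "Q i 0 = Q j 0"
    and last_hub: "Q i L = Q j L"
    and strands_disjoint: "\<lbrakk>i < m; j < m; s \<le> L; t \<le> L; Q i s = Q j t\<rbrakk>
          \<Longrightarrow> s = t \<and> (i = j \<or> s = 0 \<or> s = L)"
    and verts_eq: "verts G = {Q i s |i s. i < m \<and> s \<le> L}"
    and dominates_iff: "u \<rightarrow> v \<longleftrightarrow> (\<exists>i<m. \<exists>s<L. u = Q i s \<and> v = Q i (Suc s)
          \<or> v = Q i s \<and> u = Q i (Suc s))"
begin

lemma reversed: "theta_graph G (\<lambda>i s. Q i (L - s)) m L"
proof (unfold_locales, goal_cases)
  case (5 i j s t)
  then show ?case using strands_disjoint[of i j "L - s" "L - t"] by auto
next
  case 6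
  show ?case unfolding verts_eq
    by (intro set_eqI iffI; clarsimp) (metis diff_le_self diff_diff_cancel)+
next
  case (7 u v)
  have "(\<exists>s<L. P s (Suc s)) \<longleftrightarrow> (\<exists>s<L. P (L - Suc s) (L - s))" for P :: "nat \<Rightarrow> nat \<Rightarrow> bool"
  proof
    assume "\<exists>s<L. P s (Suc s)"
    then obtain s where "s < L" "P s (Suc s)" by blast
    then show "\<exists>s<L. P (L - Suc s) (L - s)"
      by (intro exI[of _ "L - Suc s"]) (auto simp: Suc_diff_Suc)
  next
    assume "\<exists>s<L. P (L - Suc s) (L - s)"
    then obtain s where "s < L" "P (L - Suc s) (L - s)" by blast
    then show "\<exists>s<L. P s (Suc s)"
      by (intro exI[of _ "L - Suc s"]) (auto simp: Suc_diff_Suc)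
  qed
  from this[of "\<lambda>s t. u = Q i s \<and> v = Q i t \<or> v = Q i s \<and> u = Q i t" for i]
  show ?case unfolding dominates_iff by blast
qed (use two_strands length_strand first_hub last_hub in simp_all)

lemma Q_eq_iff:
  assumes "i < m" "j < m" "s \<le> L" "t \<le> L"
  shows "Q i s = Q j t \<longleftrightarrow> s = t \<and> (i = j \<or> s = 0 \<or> s = L)"
  using strands_disjoint[OF assms] first_hub[of i j] last_hub[of i j] by auto

lemma Q_in_verts: "i < m \<Longrightarrow> s \<le> L \<Longrightarrow> Q i s \<in> verts G"
  using verts_eq by blast

lemma dominates_strand: "i < m \<Longrightarrow> s < L \<Longrightarrow> Q i s \<rightarrow> Q i (Suc s)"
  using dominates_iff by blast

lemma inner_neighbour:
  assumes "i < m" "0 < s" "s < L" "Q i s \<rightarrow> v"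
  shows "v = Q i (Suc s) \<or> v = Q i (s - 1)"
proof -
  obtain k t where kt: "k < m" "t < L"
    "Q i s = Q k t \<and> v = Q k (Suc t) \<or> v = Q k t \<and> Q i s = Q k (Suc t)"
    using assms(4) unfolding dominates_iff by blast
  then show ?thesis using assms strands_disjoint[of i k s t] strands_disjoint[of i k s "Suc t"]
    by auto
qed

lemma first_hub_neighbour:
  assumes "i < m" "Q i 0 \<rightarrow> v"
  obtains k where "k < m" "v = Q k 1"
proof -
  obtain k t where kt: "k < m" "t < L"
    "Q i 0 = Q k t \<and> v = Q k (Suc t) \<or> v = Q k t \<and> Q i 0 = Q k (Suc t)"
    using assms(2) unfolding dominates_iff by blast
  then show ?thesis using assms that strands_disjoint[of i k 0 t] strands_disjoint[of i k 0 "Suc t"]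
    by auto
qed

text \<open>
  The vertices inside a strand have degree 2, so a walk that does not turn back follows the strand
  to its end. The walk is a function, so that the lemma applies to paths and to cycles.
\<close>

lemma follow_strand:
  assumes "i < m" "f a = Q i s" "f (Suc a) = Q i (Suc s)" "s + t \<le> L"
    and adj: "\<And>e. a \<le> e \<Longrightarrow> e < a + t \<Longrightarrow> f e \<rightarrow> f (Suc e)"
    and no_return: "\<And>e. a \<le> e \<Longrightarrow> Suc e < a + t \<Longrightarrow> f e \<noteq> f (Suc (Suc e))"
  shows "f (a + t) = Q i (s + t)"
  using assms(4-)
proof (induction t rule: less_induct)
  case (less t)
  consider "t = 0" | "t = 1" | r where "t = Suc (Suc r)"
    by (metis One_nat_def not0_implies_Suc)
  then show ?case
  proof cases
    case 3
    have "f (a + r) = Q i (s + r)" "f (a + Suc r) = Q i (s + Suc r)"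
      using less.IH[of r] less.IH[of "Suc r"] less.prems 3 by simp_all
    moreover have "f (a + Suc r) \<rightarrow> f (a + t)" "f (a + r) \<noteq> f (a + t)"
      using less.prems(2)[of "a + Suc r"] less.prems(3)[of "a + r"] 3 by simp_all
    ultimately show ?thesis
      using inner_neighbour[of i "s + Suc r" "f (a + t)"] less.prems(1) 3 assms(1) by auto
  qed (use assms in simp_all)
qed

lemma follow_strand_back:
  assumes "i < m" "f a = Q i s" "f (Suc a) = Q i (s - 1)" "t \<le> s" "s \<le> L"
    and "\<And>e. a \<le> e \<Longrightarrow> e < a + t \<Longrightarrow> f e \<rightarrow> f (Suc e)"
    and "\<And>e. a \<le> e \<Longrightarrow> Suc e < a + t \<Longrightarrow> f e \<noteq> f (Suc (Suc e))"
  shows "f (a + t) = Q i (s - t)"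
proof (cases "s = 0")
  case False
  interpret rev: theta_graph G "\<lambda>i s. Q i (L - s)" m L by (rule reversed)
  have "L - Suc (L - s) = s - 1" using \<open>s \<le> L\<close> by simp
  then show ?thesis
    using rev.follow_strand[of i f a "L - s" t] assms False by simp
qed (use assms in simp)

subsection \<open>Connectivity\<close>

lemma reach_first_hub:
  assumes "i < m" "s \<le> L" "\<forall>t\<le>s. Q i t \<notin> S"
  shows "Q i s \<rightarrow>\<^sup>*\<^bsub>G \<restriction> (verts G - S)\<^esub> Q i 0"
  using assms(2,3)
proof (induction s)
  case 0
  then show ?case using assms(1)
    by (intro wf_digraph.reachable_refl[OF wellformed_induce_subgraph]) (auto simp: verts_eq)
next
  case (Suc s)
  have "Q i (Suc s) \<rightarrow> Q i s"
    using dominates_iff Suc.prems assms(1) by (metis Suc_le_lessD)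
  moreover have "Q i s \<in> verts G - S" "Q i (Suc s) \<in> verts G - S"
    using Suc.prems assms(1) by (auto simp: verts_eq) (metis Suc_leD)+
  ultimately have "Q i (Suc s) \<rightarrow>\<^bsub>G \<restriction> (verts G - S)\<^esub> Q i s"
    by (auto simp: arcs_ends_conv)
  then show ?case
    using Suc wf_digraph.adj_reachable_trans[OF wellformed_induce_subgraph] by simp
qed

lemma reach_last_hub:
  assumes "i < m" "s \<le> L" "\<forall>t. s \<le> t \<and> t \<le> L \<longrightarrow> Q i t \<notin> S"
  shows "Q i s \<rightarrow>\<^sup>*\<^bsub>G \<restriction> (verts G - S)\<^esub> Q i L"
proof -
  interpret rev: theta_graph G "\<lambda>i s. Q i (L - s)" m L by (rule reversed)
  show ?thesis using rev.reach_first_hub[of i "L - s" S] assms by simp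
qed

text \<open>
  A deleted vertex blocks a strand on one side only of any other vertex, so every vertex still
  reaches a hub; and if both hubs remain, one of two strands still joins them.
\<close>

lemma connected_delete_vertex:
  assumes "S \<subseteq> {w}"
  shows "connected (G \<restriction> (verts G - S))"
proof -
  let ?H = "G \<restriction> (verts G - S)"
  interpret H: wf_digraph ?H by (rule wellformed_induce_subgraph)
  have sym: "symmetric ?H"
    by (rule induced_graph_imp_symmetric[OF sym_arcs induced_induce]) auto
  have m: "0 < m" "1 < m" using two_strands by auto
  have hubs: "Q 0 0 \<in> verts G" "Q 0 L \<in> verts G" "Q 0 0 \<noteq> Q 0 L"
    using m length_strand by (auto simp: Q_in_verts Q_eq_iff)
  have reach: "v \<rightarrow>\<^sup>*\<^bsub>?H\<^esub> Q 0 0 \<or> v \<rightarrow>\<^sup>*\<^bsub>?H\<^esub> Q 0 L" if v: "v \<in> verts ?H" for v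
  proof (rule ccontr)
    assume none: "\<not> ?thesis"
    obtain i s where at: "i < m" "s \<le> L" "v = Q i s"
      using v by (auto simp: verts_eq)
    obtain t where t: "t \<le> s" "Q i t \<in> S"
      using none reach_first_hub[of i s S] at first_hub[of i 0] by auto
    obtain t' where t': "s \<le> t'" "t' \<le> L" "Q i t' \<in> S"
      using none reach_last_hub[of i s S] at last_hub[of i 0] by auto
    have "Q i t = Q i t'" using t t' assms by blast
    then have "t = s" using t t' at Q_eq_iff[of i i t t'] by simp
    then show False using t v at by simp
  qed
  have "\<exists>h\<in>verts ?H. \<forall>v\<in>verts ?H. v \<rightarrow>\<^sup>*\<^bsub>?H\<^esub> h"
  proof (cases "Q 0 0 \<in> S \<or> Q 0 L \<in> S")
    case True
    then show ?thesis
      using reach hubs assms H.reachable_in_verts(2) by (metis DiffD2 DiffI induce_subgraph_verts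
        singletonD subsetD)
  next
    case False
    have "\<exists>k<m. \<forall>s\<le>L. Q k s \<notin> S"
    proof (rule ccontr)
      assume "\<not> ?thesis"
      then obtain s t where st: "s \<le> L" "Q 0 s \<in> S" "t \<le> L" "Q 1 t \<in> S"
        using m by blast
      then have "Q 0 s = Q 1 t" using assms by blast
      then have "s = 0 \<or> s = L" using Q_eq_iff[of 0 1 s t] m st by auto
      then show False using st False by auto
    qed
    then obtain k where k: "k < m" "\<forall>s\<le>L. Q k s \<notin> S" by blast
    have "Q 0 L \<rightarrow>\<^sup>*\<^bsub>?H\<^esub> Q 0 0"
      using reach_first_hub[of k L S] k first_hub[of k 0] last_hub[of k 0] by auto
    then show ?thesis
      using reach hubs False H.reachable_trans by (metis DiffI induce_subgraph_verts)
  qed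
  then have "strongly_connected ?H"
    using symmetric_reachable[OF sym] H.reachable_trans
    by (intro strongly_connectedI) (blast, metis)
  then show ?thesis
    unfolding connected_def strongly_connected_def
    using H.reachable_mk_symmetricI by simp
qed

lemma two_connected: "k_connected 2 G"
  unfolding k_connected_def
proof (intro conjI allI impI)
  have "{Q 0 0, Q 0 1, Q 0 2} \<subseteq> verts G" "card {Q 0 0, Q 0 1, Q 0 2} = 3"
    using two_strands length_strand by (auto simp: Q_in_verts Q_eq_iff)
  then show "2 < card (verts G)"
    using card_mono[OF finite_verts] by (metis Suc_le_eq eval_nat_numeral(3))
next
  fix S assume S: "S \<subseteq> verts G \<and> card S < 2"
  then have "finite S" "card S \<le> Suc 0" using finite_subset[OF _ finite_verts] by auto
  then have "\<exists>w. S \<subseteq> {w}"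
    by (metis card_le_Suc0_iff_eq singletonI subsetI)
  then show "connected (G \<restriction> (verts G - S))"
    using connected_delete_vertex by blast
qed

subsection \<open>Girth\<close>

text \<open>
  A closed walk that never turns back follows its first strand to a hub and then runs through the
  next strand from end to end, which already gives \<open>L + 1\<close> distinct vertices.
\<close>

lemma walk_contains_strand:
  assumes adj: "\<And>e. f e \<rightarrow> f (Suc e)"
    and no_return: "\<And>e. f e \<noteq> f (Suc (Suc e))"
  shows "\<exists>g. inj_on g {..L} \<and> g ` {..L} \<subseteq> range f"
proof -
  interpret rev: theta_graph G "\<lambda>i s. Q i (L - s)" m L by (rule reversed)
  obtain i s where at: "i < m" "s < L"
    "f 0 = Q i s \<and> f 1 = Q i (Suc s) \<or> f 1 = Q i s \<and> f 0 = Q i (Suc s)"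
    using adj[of 0] unfolding dominates_iff One_nat_def by blast
  have hub: "\<exists>a. f a = Q 0 0 \<or> f a = Q 0 L"
    using at(3)
  proof (elim disjE conjE)
    assume "f 0 = Q i s" "f 1 = Q i (Suc s)"
    then have "f (0 + (L - s)) = Q i (s + (L - s))"
      using at follow_strand[of i f 0 s "L - s"] adj no_return by simp
    then show ?thesis using at last_hub[of i 0] by auto
  next
    assume "f 1 = Q i s" "f 0 = Q i (Suc s)"
    then have "f (0 + Suc s) = Q i (Suc s - Suc s)"
      using at follow_strand_back[of i f 0 "Suc s" "Suc s"] adj no_return by simp
    then show ?thesis using first_hub[of i 0] by auto
  qed
  have m: "0 < m" using two_strands by simp
  from hub obtain a where "f a = Q 0 0 \<or> f a = Q 0 L" by blast
  then obtain k where k: "k < m" "(\<forall>t\<le>L. f (a + t) = Q k t) \<or> (\<forall>t\<le>L. f (a + t) = Q k (L - t))"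
  proof (elim disjE)
    assume a: "f a = Q 0 0"
    then obtain k where k: "k < m" "f (Suc a) = Q k 1"
      using first_hub_neighbour[of 0] adj[of a] m by metis
    have "f (a + t) = Q k (0 + t)" if "t \<le> L" for t
      using follow_strand[of k f a 0 t] a k that first_hub[of k 0] adj no_return by simp
    then show ?thesis using that k by auto
  next
    assume a: "f a = Q 0 L"
    then obtain k where k: "k < m" "f (Suc a) = Q k (L - 1)"
      using rev.first_hub_neighbour[of 0] adj[of a] m by (metis diff_zero)
    have "f (a + t) = Q k (L - t)" if "t \<le> L" for t
      using follow_strand_back[of k f a L t] a k that last_hub[of k 0] adj no_return by simp
    then show ?thesis using that k by auto
  qed
  have "inj_on (\<lambda>t. f (a + t)) {..L}"
    using k(2)
  proof
    assume "\<forall>t\<le>L. f (a + t) = Q k t"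
    then show ?thesis using k(1) Q_eq_iff[of k k] by (auto simp: inj_on_def)
  next
    assume "\<forall>t\<le>L. f (a + t) = Q k (L - t)"
    then show ?thesis using k(1) Q_eq_iff[of k k "L - s" "L - t" for s t]
      by (auto simp: inj_on_def)
  qed
  then show ?thesis by (intro exI[of _ "\<lambda>t. f (a + t)"]) auto
qed

text \<open>
  Going round the cycle for ever gives a walk as above. It does not turn back: vertices two steps
  apart on a cycle of length at least 3 are distinct.
\<close>

lemma length_cycle:
  assumes "cycle p" "3 \<le> length p"
  shows "L < length p"
proof -
  let ?n = "length p"
  define f where "f e = tail G (p ! (e mod ?n))" for e
  obtain u where u: "awalk u p u" "distinct (tl (awalk_verts u p))" "p \<noteq> []"
    using assms(1) by (auto simp: cycle_def)
  have n: "0 < ?n" using u by simp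
  have ends: "awalk_verts u p = map (tail G) p @ [head G (last p)]"
    "awalk_verts u p = tail G (hd p) # map (head G) p"
    using u awalk_verts_conv[of u p] awalk_verts_conv'[of u p u] by (auto simp: awalk_def)
  have heads: "head G (p ! e) = tail G (p ! Suc e)" if "Suc e < ?n" for e
  proof -
    have "awalk_verts u p ! Suc e = tail G (p ! Suc e)"
      using that unfolding ends(1) by (simp add: nth_append)
    moreover have "awalk_verts u p ! Suc e = head G (p ! e)"
      using that unfolding ends(2) by simp
    ultimately show ?thesis by simp
  qed
  have last: "head G (last p) = tail G (hd p)"
    using u(1) ends by (metis awalkE hd_append2 last_snoc list.sel(1))
  have adj: "f e \<rightarrow> f (Suc e)" for e
  proof -
    have lt: "e mod ?n < ?n" using n by simp
    have "head G (p ! (e mod ?n)) = f (Suc e)"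
    proof (cases "Suc (e mod ?n) = ?n")
      case True
      then have "e mod ?n = ?n - 1" "Suc e mod ?n = 0"
        by (auto simp: mod_Suc)
      then show ?thesis
        using last u(3) unfolding f_def by (simp add: last_conv_nth hd_conv_nth)
    next
      case False
      then show ?thesis using heads[of "e mod ?n"] lt unfolding f_def by (simp add: mod_Suc)
    qed
    moreover have "p ! (e mod ?n) \<in> arcs G" using u(1) lt by (auto simp: awalk_def)
    ultimately show ?thesis unfolding f_def arcs_ends_conv by force
  qed
  have "mset (map (tail G) p @ [head G (last p)]) = mset (tail G (hd p) # map (head G) p)"
    using ends by simp
  then have "mset (map (tail G) p) = mset (map (head G) p)"
    using last by simp
  moreover have "distinct (map (head G) p)" using u(2) ends(2) by simp
  ultimately have "distinct (map (tail G) p)"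
    using mset_eq_imp_distinct_iff by blast
  then have f_inj: "f e = f e' \<longleftrightarrow> e mod ?n = e' mod ?n" for e e'
    using n nth_eq_iff_index_eq[of "map (tail G) p" "e mod ?n" "e' mod ?n"]
    by (simp add: f_def)
  have "f e \<noteq> f (Suc (Suc e))" for e
  proof
    assume "f e = f (Suc (Suc e))"
    then have "?n dvd 2"
      using f_inj mod_eq_dvd_iff_nat[of e "Suc (Suc e)" ?n] by simp
    then show False using assms(2) by (auto dest: dvd_imp_le)
  qed
  then obtain g where g: "inj_on g {..L}" "g ` {..L} \<subseteq> range f"
    using walk_contains_strand[of f] adj by blast
  have "range f \<subseteq> tail G ` set p" using n by (auto simp: f_def)
  then have "card (g ` {..L}) \<le> card (tail G ` set p)"
    using g by (intro card_mono) auto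
  also have "\<dots> \<le> ?n"
    using card_image_le[of "set p" "tail G"] card_length[of p] by simp
  finally show ?thesis using g by (simp add: card_image)
qed

lemma girth_gt: "enat (Suc L) \<le> girth G"
  unfolding girth_def using length_cycle by (auto intro!: INF_greatest Suc_leI)

subsection \<open>Three colours are not enough\<close>

text \<open>
  The edges of the strands \<open>i\<close> and \<open>j\<close> at position 0 have the same colour, so the path cannot
  pass from one to the other at that hub. Nor can it come back to a hub, so after the third strand
  it must end on strand \<open>j\<close>.
\<close>

lemma strongly_proper_detour:
  assumes ij: "i < m" "j < m" "i \<noteq> j" and s: "0 < s" "s < L"
    and path: "strongly_proper_path G c p" "hd p = Q i s" "last p = Q j s"
    and down: "p ! 1 = Q i (s - 1)"
    and same: "c {Q i 0, Q i 1} = c {Q j 0, Q j 1}"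
  shows "length p = 2 * L + 1" "t \<le> s \<Longrightarrow> p ! t = Q i (s - t)"
    "t \<le> L - s \<Longrightarrow> p ! (s + L + t) = Q j (L - t)"
proof -
  interpret rev: theta_graph G "\<lambda>i s. Q i (L - s)" m L by (rule reversed)
  let ?n = "length p"
  have vp: "vpath p G" using path by (simp add: strongly_proper_path_def)
  then have "p \<noteq> []" by (auto simp: vpath_def vwalk_def)
  have adj: "p ! e \<rightarrow> p ! Suc e" if "Suc e < ?n" for e
    using vpath_nth_dominates[OF vp that] .
  have dist: "p ! e = p ! f \<longleftrightarrow> e = f" if "e < ?n" "f < ?n" for e f
    using vp that by (auto simp: vpath_def nth_eq_iff_index_eq)
  have p0: "p ! 0 = Q i s" and plast: "p ! (?n - 1) = Q j s"
    using path \<open>p \<noteq> []\<close> by (auto simp: hd_conv_nth last_conv_nth)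
  have first: "p ! t = Q i (s - t)" if "t \<le> s" "t < ?n" for t
    using follow_strand_back[of i "(!) p" 0 s t] p0 down ij s adj dist that by simp
  have n1: "s + 1 < ?n"
  proof (rule ccontr)
    assume "\<not> ?thesis"
    then have "Q j s = Q i (s - (?n - 1))"
      using first[of "?n - 1"] plast \<open>p \<noteq> []\<close> by (simp add: Suc_le_eq)
    moreover have "s - (?n - 1) \<le> L" using s by simp
    ultimately show False using ij s Q_eq_iff[of j i s "s - (?n - 1)"] by simp
  qed
  have at_hub: "p ! s = Q i 0" "p ! (s - 1) = Q i 1"
    using first[of s] first[of "s - 1"] n1 s by auto
  obtain k where k: "k < m" "p ! Suc s = Q k 1"
    using first_hub_neighbour[of i] adj[of s] at_hub ij n1 by auto
  have "s - 1 < ?n" "Suc s \<noteq> s - 1" using n1 by auto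
  then have "k \<noteq> i"
    using k at_hub dist[of "Suc s" "s - 1"] n1 by auto
  have "k \<noteq> j"
  proof
    assume "k = j"
    have "colour_seq c p ! (s - 1) \<noteq> colour_seq c p ! s"
      using path(1) s n1 unfolding strongly_proper_path_def by (simp add: length_colour_seq)
    moreover have "colour_seq c p ! (s - 1) = c {Q i 0, Q i 1}"
      using nth_colour_seq[of "s - 1" p c] n1 s at_hub by (simp add: insert_commute)
    moreover have "colour_seq c p ! s = c {Q j 0, Q j 1}"
      using nth_colour_seq[of s p c] n1 at_hub k \<open>k = j\<close> first_hub[of i j] by simp
    ultimately show False using same by simp
  qed
  have second: "p ! (s + t) = Q k t" if "t \<le> L" "s + t < ?n" for t
    using follow_strand[of k "(!) p" s 0 t] at_hub first_hub[of i k] k adj dist that by simp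
  have n2: "s + L + 1 < ?n"
  proof (rule ccontr)
    assume *: "\<not> ?thesis"
    then have "Q j s = Q k (?n - 1 - s)"
      using second[of "?n - 1 - s"] plast n1 by simp
    moreover have "?n - 1 - s \<le> L" using * by linarith
    ultimately show False using ij s k \<open>k \<noteq> j\<close> Q_eq_iff[of j k s "?n - 1 - s"] by simp
  qed
  have at_hub2: "p ! (s + L) = Q k L" using second[of L] n2 by simp
  obtain l where l: "l < m" "p ! Suc (s + L) = Q l (L - 1)"
    using rev.first_hub_neighbour[of k] adj[of "s + L"] at_hub2 k n2 by auto
  have third: "p ! (s + L + t) = Q l (L - t)" if "t \<le> L" "s + L + t < ?n" for t
    using follow_strand_back[of l "(!) p" "s + L" L t] at_hub2 last_hub[of k l] l adj dist that
    by simp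
  have n3: "?n \<le> s + L + L"
  proof (rule ccontr)
    assume *: "\<not> ?thesis"
    then have "p ! (s + L + L) = p ! s"
      using third[of L] at_hub first_hub[of i l] by simp
    then show False using dist[of "s + L + L" s] * s by simp
  qed
  define r where "r = ?n - 1 - (s + L)"
  have r: "0 < r" "r < L" "?n = s + L + r + 1" using n2 n3 by (auto simp: r_def)
  have "Q j s = Q l (L - r)" using third[of r] plast r by simp
  then have "s = L - r" "j = l" using Q_eq_iff[of j l s "L - r"] ij l s by auto
  show len: "length p = 2 * L + 1" using r \<open>s = L - r\<close> by simp
  show "p ! t = Q i (s - t)" if "t \<le> s" using first[of t] that n1 by simp
  show "p ! (s + L + t) = Q j (L - t)" if "t \<le> L - s"
    using third[of t] that len s \<open>j = l\<close> by simp
qed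

text \<open>
  The two cases are the two hubs through which the path can leave strand \<open>i\<close>; reading the strands
  backwards reduces the second one to the first.
\<close>

lemma detour_colours:
  assumes ij: "i < m" "j < m" "i \<noteq> j" and s: "0 < s" "s < L"
    and spc: "strongly_proper_connected G c"
    and same: "c {Q i 0, Q i 1} = c {Q j 0, Q j 1}"
      "c {Q i (L - 1), Q i L} = c {Q j (L - 1), Q j L}"
  obtains p where "strongly_proper_path G c p" "length (colour_seq c p) = 2 * L"
    "(\<forall>t<s. colour_seq c p ! t = c {Q i (s - Suc t), Q i (s - t)}) \<and>
       (\<forall>t<L - s. colour_seq c p ! (s + L + t) = c {Q j (L - Suc t), Q j (L - t)})
     \<or> (\<forall>t<L - s. colour_seq c p ! t = c {Q i (s + t), Q i (s + Suc t)}) \<and>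
       (\<forall>t<s. colour_seq c p ! (L - s + L + t) = c {Q j t, Q j (Suc t)})"
proof -
  interpret rev: theta_graph G "\<lambda>i s. Q i (L - s)" m L by (rule reversed)
  have "Q i s \<in> verts G" "Q j s \<in> verts G" "Q i s \<noteq> Q j s"
    using ij s by (auto simp: Q_in_verts Q_eq_iff)
  then obtain p where p: "strongly_proper_path G c p" "hd p = Q i s" "last p = Q j s"
    using spc unfolding strongly_proper_connected_def by blast
  have vp: "vpath p G" using p by (simp add: strongly_proper_path_def)
  then have "p \<noteq> []" by (auto simp: vpath_def vwalk_def)
  moreover have "length p \<noteq> 1"
    using p \<open>Q i s \<noteq> Q j s\<close> by (auto simp: length_Suc_conv)
  ultimately have "1 < length p" by (cases p) auto
  then have "Q i s \<rightarrow> p ! 1"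
    using vpath_nth_dominates[OF vp, of 0] p(2) \<open>p \<noteq> []\<close> by (simp add: hd_conv_nth)
  then consider "p ! 1 = Q i (s - 1)" | "p ! 1 = Q i (Suc s)"
    using inner_neighbour ij s by blast
  then show ?thesis
  proof cases
    case 1
    note detour = strongly_proper_detour[OF ij s p 1 same(1)]
    have "colour_seq c p ! t = c {Q i (s - Suc t), Q i (s - t)}" if "t < s" for t
      using that s detour(1) detour(2)[of t] detour(2)[of "Suc t"]
      by (simp add: nth_colour_seq insert_commute)
    moreover have "colour_seq c p ! (s + L + t) = c {Q j (L - Suc t), Q j (L - t)}"
      if "t < L - s" for t
      using that s detour(1) detour(3)[of t] detour(3)[of "Suc t"]
      by (simp add: nth_colour_seq insert_commute)
    ultimately show ?thesis
      using that[OF p(1)] detour(1) by (simp add: length_colour_seq)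
  next
    case 2
    have s': "0 < L - s" "L - s < L" "L - (L - s) = s" "L - (L - s - 1) = Suc s"
      using s by auto
    have same': "c {Q i (L - 0), Q i (L - 1)} = c {Q j (L - 0), Q j (L - 1)}"
      using same(2) by (metis insert_commute diff_zero)
    have ends: "hd p = Q i (L - (L - s))" "last p = Q j (L - (L - s))"
      "p ! 1 = Q i (L - (L - s - 1))"
      using p 2 s' by simp_all
    note detour = rev.strongly_proper_detour[OF ij s'(1,2) p(1) ends same']
    note len = detour(1)
    have up: "p ! t = Q i (s + t)" if "t \<le> L - s" for t
    proof -
      have "L - (L - s - t) = s + t" using that s by simp
      then show ?thesis using detour(2)[OF that] by simp
    qed
    have down: "p ! (L - s + L + t) = Q j t" if "t \<le> s" for t
      using detour(3)[of t] that s by simp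
    have "colour_seq c p ! t = c {Q i (s + t), Q i (s + Suc t)}" if "t < L - s" for t
      using that s len up[of t] up[of "Suc t"] by (simp add: nth_colour_seq)
    moreover have "colour_seq c p ! (L - s + L + t) = c {Q j t, Q j (Suc t)}"
      if "t < s" for t
      using that s len down[of t] down[of "Suc t"] by (simp add: nth_colour_seq)
    ultimately show ?thesis
      using that[OF p(1)] len by (simp add: length_colour_seq)
  qed
qed

text \<open>
  The bound on \<open>m\<close> is \<open>3 ^ 3 + 1\<close>, for the pigeonhole principle on the colours of three edges of each
  strand; \<open>5 \<le> L\<close> makes position 4 an inner vertex. Edges 0 and \<open>L - 1\<close> serve to exclude the direct
  passages at the hubs, edges 0 and 3 to derive the contradiction.
\<close>

lemma three_colours_insufficient:
  assumes "28 \<le> m" "5 \<le> L" "\<not> 3 dvd L"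
    and three: "\<forall>(u, v)\<in>arcs_ends G. c {u, v} < 3"
  shows "\<not> strongly_proper_connected G c"
proof
  assume spc: "strongly_proper_connected G c"
  define e where "e i s = c {Q i s, Q i (Suc s)}" for i s
  have e3: "e i s < 3" if "i < m" "s < L" for i s
    using three dominates_strand[OF that] unfolding e_def by auto
  let ?h = "\<lambda>i. (e i 0, e i 3, e i (L - 1))"
  have "?h ` {..<m} \<subseteq> {..<3} \<times> {..<3} \<times> {..<3}"
    using e3 assms(2) by auto
  then have "card (?h ` {..<m}) \<le> 27"
    using card_mono[of "{..<3} \<times> {..<3} \<times> {..<3::nat}" "?h ` {..<m}"]
    by (simp add: card_cartesian_product)
  then have "\<not> inj_on ?h {..<m}"
    using assms(1) by (auto dest: card_image)
  then obtain i j where ij: "i < m" "j < m" "i \<noteq> j" and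
    agree: "e i 0 = e j 0" "e i 3 = e j 3" "e i (L - 1) = e j (L - 1)"
    by (auto simp: inj_on_def)
  have same: "c {Q i 0, Q i 1} = c {Q j 0, Q j 1}"
    "c {Q i (L - 1), Q i L} = c {Q j (L - 1), Q j L}"
    using agree assms(2) by (simp_all add: e_def)
  have periodic: "colour_seq c p ! a = colour_seq c p ! b \<longleftrightarrow> 3 dvd b - a"
    if p: "strongly_proper_path G c p" and "a \<le> b" "b < length (colour_seq c p)" for p a b
  proof (rule three_colours_periodic)
    fix a assume "a < length (colour_seq c p)"
    then have "Suc a < length p" by (simp add: length_colour_seq)
    then show "colour_seq c p ! a < 3"
      using vpath_nth_dominates[of p G a] p three
      by (auto simp: nth_colour_seq strongly_proper_path_def)
  qed (use that in \<open>auto simp: strongly_proper_path_def\<close>)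
  \<comment> \<open>From position 1, the paths meet edge 0 of one strand and edge 3 of the other.\<close>
  have ne: "e i 0 \<noteq> e i 3"
  proof -
    obtain p where p: "strongly_proper_path G c p" "length (colour_seq c p) = 2 * L"
      and w: "(\<forall>t<1. colour_seq c p ! t = c {Q i (1 - Suc t), Q i (1 - t)}) \<and>
       (\<forall>t<L - 1. colour_seq c p ! (1 + L + t) = c {Q j (L - Suc t), Q j (L - t)})
     \<or> (\<forall>t<L - 1. colour_seq c p ! t = c {Q i (1 + t), Q i (1 + Suc t)}) \<and>
       (\<forall>t<1. colour_seq c p ! (L - 1 + L + t) = c {Q j t, Q j (Suc t)})"
      using detour_colours[OF ij _ _ spc same, of 1] assms(2) by auto
    have "\<not> 3 dvd 2 * L - 3"
      using assms(2,3) by presburger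
    from w show ?thesis
    proof (elim disjE conjE)
      assume w: "\<forall>t<1. colour_seq c p ! t = c {Q i (1 - Suc t), Q i (1 - t)}"
        "\<forall>t<L - 1. colour_seq c p ! (1 + L + t) = c {Q j (L - Suc t), Q j (L - t)}"
      have "1 + L + (L - 4) = 2 * L - 3" "L - Suc (L - 4) = 3" "L - (L - 4) = Suc 3"
        using assms(2) by auto
      then have "colour_seq c p ! 0 = e i 0" "colour_seq c p ! (2 * L - 3) = e j 3"
        using w(1) w(2)[rule_format, of "L - 4"] assms(2) by (auto simp: e_def)
      then show ?thesis
        using periodic[OF p(1), of 0 "2 * L - 3"] \<open>\<not> 3 dvd 2 * L - 3\<close> p(2) assms(2) agree by auto
    next
      assume w: "\<forall>t<L - 1. colour_seq c p ! t = c {Q i (1 + t), Q i (1 + Suc t)}"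
        "\<forall>t<1. colour_seq c p ! (L - 1 + L + t) = c {Q j t, Q j (Suc t)}"
      have "L - 1 + L + 0 = 2 * L - 1" "2 * L - 1 - 2 = 2 * L - 3" "2 \<le> 2 * L - 1"
        using assms(2) by auto
      then have "colour_seq c p ! 2 = e i 3" "colour_seq c p ! (2 * L - 1) = e j 0"
        using w(1)[rule_format, of 2] w(2)[rule_format, of 0] assms(2)
        by (simp_all add: e_def eval_nat_numeral)
      then show ?thesis
        using periodic[OF p(1), of 2 "2 * L - 1"] \<open>\<not> 3 dvd 2 * L - 3\<close> p(2) assms(2) agree
          \<open>2 * L - 1 - 2 = 2 * L - 3\<close> \<open>2 \<le> 2 * L - 1\<close> by auto
    qed
  qed
  \<comment> \<open>From position 4, the paths run through the edges 0 to 3 of a single strand.\<close>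
  have eq: "e i 0 = e i 3"
  proof -
    obtain p where p: "strongly_proper_path G c p" "length (colour_seq c p) = 2 * L"
      and w: "(\<forall>t<4. colour_seq c p ! t = c {Q i (4 - Suc t), Q i (4 - t)}) \<and>
       (\<forall>t<L - 4. colour_seq c p ! (4 + L + t) = c {Q j (L - Suc t), Q j (L - t)})
     \<or> (\<forall>t<L - 4. colour_seq c p ! t = c {Q i (4 + t), Q i (4 + Suc t)}) \<and>
       (\<forall>t<4. colour_seq c p ! (L - 4 + L + t) = c {Q j t, Q j (Suc t)})"
      using detour_colours[OF ij _ _ spc same, of 4] assms(2) by auto
    from w show ?thesis
    proof (elim disjE conjE)
      assume w: "\<forall>t<4. colour_seq c p ! t = c {Q i (4 - Suc t), Q i (4 - t)}"
      have "colour_seq c p ! 0 = e i 3" "colour_seq c p ! 3 = e i 0"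
        using w[rule_format, of 0] w[rule_format, of 3] by (simp_all add: e_def)
      then show ?thesis
        using periodic[OF p(1), of 0 3] p(2) assms(2) by auto
    next
      assume w: "\<forall>t<4. colour_seq c p ! (L - 4 + L + t) = c {Q j t, Q j (Suc t)}"
      have "L - 4 + L + 0 = 2 * L - 4" "L - 4 + L + 3 = 2 * L - 1"
        using assms(2) by auto
      then have "colour_seq c p ! (2 * L - 4) = e j 0" "colour_seq c p ! (2 * L - 1) = e j 3"
        using w[rule_format, of 0] w[rule_format, of 3] by (simp_all add: e_def)
      moreover have "3 dvd 2 * L - 1 - (2 * L - 4)"
        using assms(2) by presburger
      then have "colour_seq c p ! (2 * L - 4) = colour_seq c p ! (2 * L - 1)"
        by (subst periodic[OF p(1)]) (use p(2) assms(2) in simp_all)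
      ultimately show ?thesis using agree by simp
    qed
  qed
  show False using ne eq by simp
qed

lemma spc_ge_4:
  assumes "28 \<le> m" "5 \<le> L" "\<not> 3 dvd L"
  shows "4 \<le> spc G"
proof -
  have "G \<restriction> (verts G - {}) = G"
    by (simp add: induce_subgraph_def Collect_conj_eq Int_absorb2 subset_iff)
  then have "connected G" using connected_delete_vertex[of "{}"] by simp
  from LeastI_ex[OF ex_strongly_proper_colouring[OF this]]
  have "\<exists>c. (\<forall>(u, v)\<in>arcs_ends G. c {u, v} < spc G) \<and> strongly_proper_connected G c"
    unfolding spc_def .
  then obtain c where c: "\<forall>(u, v)\<in>arcs_ends G. c {u, v} < spc G" "strongly_proper_connected G c"
    by blast
  show ?thesis
  proof (rule ccontr)
    assume "\<not> ?thesis"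
    then have "\<forall>(u, v)\<in>arcs_ends G. c {u, v} < 3"
      using c(1) by fastforce
    then show False using three_colours_insufficient[OF assms] c(2) by blast
  qed
qed

end

section \<open>Theta graphs on the natural numbers\<close>

text \<open>The hubs are \<open>0\<close> and \<open>1\<close>, and the inner vertices of each strand lie in its own block of
  \<open>L\<close> consecutive numbers above them.\<close>

definition strand_vertex :: "nat \<Rightarrow> nat \<Rightarrow> nat \<Rightarrow> nat" where
  "strand_vertex L i s = (if s = 0 then 0 else if s = L then 1 else i * L + s + 2)"

definition theta :: "nat \<Rightarrow> nat \<Rightarrow> (nat, nat \<times> nat) pre_digraph" where
  "theta m L = \<lparr>verts = {strand_vertex L i s |i s. i < m \<and> s \<le> L},
     arcs = {(u, v). \<exists>i<m. \<exists>s<L. u = strand_vertex L i s \<and> v = strand_vertex L i (Suc s)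
       \<or> v = strand_vertex L i s \<and> u = strand_vertex L i (Suc s)},
     tail = fst, head = snd\<rparr>"

lemma strand_vertex_disjoint:
  assumes "s \<le> L" "t \<le> L" "strand_vertex L i s = strand_vertex L j t"
  shows "s = t \<and> (i = j \<or> s = 0 \<or> s = L)"
proof (cases "s = 0 \<or> s = L \<or> t = 0 \<or> t = L")
  case True
  then show ?thesis using assms by (auto simp: strand_vertex_def split: if_splits)
next
  case False
  then have eq: "i * L + s = j * L + t" and "s < L" "t < L"
    using assms by (auto simp: strand_vertex_def)
  have "(i * L + s) mod L = s" "(j * L + t) mod L = t"
    using \<open>s < L\<close> \<open>t < L\<close> by simp_all
  then have "s = t" using eq by simp
  then show ?thesis using eq \<open>s < L\<close> by simp
qed

lemma theta_is_theta_graph: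
  assumes "2 \<le> m" "2 \<le> L"
  shows "theta_graph (theta m L) (strand_vertex L) m L"
proof -
  let ?G = "theta m L" and ?Q = "strand_vertex L"
  have ends: "arcs_ends ?G = arcs ?G" and proj: "tail ?G = fst" "head ?G = snd"
    by (auto simp: arcs_ends_conv theta_def)
  have verts: "verts ?G = {?Q i s |i s. i < m \<and> s \<le> L}"
    by (simp add: theta_def)
  have arcs: "(u, v) \<in> arcs ?G \<longleftrightarrow> (\<exists>i<m. \<exists>s<L. u = ?Q i s \<and> v = ?Q i (Suc s)
      \<or> v = ?Q i s \<and> u = ?Q i (Suc s))" for u v
    by (simp add: theta_def)
  have arc_verts: "u \<in> verts ?G \<and> v \<in> verts ?G \<and> u \<noteq> v" if "(u, v) \<in> arcs ?G" for u v
  proof -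
    obtain i s where at: "i < m" "s < L" "{u, v} = {?Q i s, ?Q i (Suc s)}"
      using \<open>(u, v) \<in> arcs ?G\<close> unfolding arcs by auto
    have "?Q i s \<in> verts ?G" "?Q i (Suc s) \<in> verts ?G"
      using at unfolding verts by (auto intro: less_imp_le Suc_leI)
    moreover have "?Q i s \<noteq> ?Q i (Suc s)"
      using strand_vertex_disjoint[of s L "Suc s" i i] at by auto
    ultimately show ?thesis using at(3) by (auto simp: doubleton_eq_iff)
  qed
  have fin: "finite (verts ?G)"
  proof -
    have "verts ?G = (\<lambda>(i, s). ?Q i s) ` ({..<m} \<times> {..L})" by (auto simp: verts)
    then show ?thesis by simp
  qed
  have "arcs ?G \<subseteq> verts ?G \<times> verts ?G" using arc_verts by auto
  then have fin': "finite (arcs ?G)" using fin by (meson finite_SigmaI finite_subset)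
  have sym: "symmetric ?G"
    unfolding symmetric_def ends by (auto simp: sym_def arcs)
  show ?thesis
  proof (unfold_locales)
    show "tail ?G e \<in> verts ?G" "head ?G e \<in> verts ?G" "tail ?G e \<noteq> head ?G e"
      if "e \<in> arcs ?G" for e
      using arc_verts[of "fst e" "snd e"] that by (simp_all add: proj)
    show "e = e'" if "arc_to_ends ?G e = arc_to_ends ?G e'" for e e'
      using that by (simp add: arc_to_ends_def proj prod_eq_iff)
    show "?Q i 0 = ?Q j 0" "?Q i L = ?Q j L" for i j
      by (simp_all add: strand_vertex_def)
    show "s = t \<and> (i = j \<or> s = 0 \<or> s = L)" if "s \<le> L" "t \<le> L" "?Q i s = ?Q j t" for i j s t
      by (rule strand_vertex_disjoint) fact+
    show "u \<rightarrow>\<^bsub>?G\<^esub> v \<longleftrightarrow> (\<exists>i<m. \<exists>s<L. u = ?Q i s \<and> v = ?Q i (Suc s)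
        \<or> v = ?Q i s \<and> u = ?Q i (Suc s))" for u v
      by (simp only: ends arcs)
  qed (fact verts assms fin fin' sym)+
qed

theorem theorem2:
  fixes d :: nat
  assumes "d \<ge> 3"
  shows "\<exists>G :: (nat, nat \<times> nat) pre_digraph.
           graph G \<and> k_connected 2 G \<and> enat d \<le> girth G \<and> spc G \<ge> 4"
proof -
  interpret theta_graph "theta 28 (3 * d + 1)" "strand_vertex (3 * d + 1)" 28 "3 * d + 1"
    by (rule theta_is_theta_graph) (use assms in auto)
  have "enat d \<le> enat (Suc (3 * d + 1))" by simp
  then have "enat d \<le> girth (theta 28 (3 * d + 1))"
    using girth_gt by (rule order_trans)
  moreover have "4 \<le> spc (theta 28 (3 * d + 1))"
  proof (rule spc_ge_4)
    show "\<not> 3 dvd 3 * d + 1" by presburger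
  qed (use assms in auto)
  ultimately show ?thesis using graph_axioms two_connected by blast
qed

end
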